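(* Let $n\in\mathbb{N}$, let $\mathcal{T}_n$ be the set of ordered set partitions of $[n]$ and $\operatorname{UPF}_n$ the set of unit-interval parking functions of length $n$. Define $\psi:\mathcal{T}_n\to\operatorname{UPF}_n$ as follows: for $B_1/\cdots/B_k\in\mathcal{T}_n$, $\psi(B_1/\cdots/B_k)=(\alpha_1,\dots,\alpha_n)$ where, for each block $B_a=\{c_1<c_2<\dots<c_m\}$ with $s=|B_1|+\dots+|B_{a-1}|$, we set $\alpha_{c_1}=s+1$ and $\alpha_{c_t}=s+t-1$ for $2\le t\le m$. Define $\phi:\operatorname{UPF}_n\to\mathcal{T}_n$ as follows: for $\alpha\in\operatorname{UPF}_n$, let $\sigma(j)$ denote the car that parks in spot $j$, and let $b_1<\dots<b_k=n$ be the breakpoints of $\alpha$ ($b_0=0$); then $\phi(\alpha)=\{\sigma(1),\dots,\sigma(b_1)\}/\{\sigma(b_1+1),\dots,\sigma(b_2)\}/\cdots/\{\sigma(b_{k-1}+1),\dots,\sigma(b_k)\}$. Then $\psi$ is well defined into $\operatorname{UPF}_n$, and $\psi$ and $\phi$ are mutually inverse bijections between $\mathcal{T}_n$ and $\operatorname{UPF}_n$.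
   Context: An ordered set partition of $[n]$ is an ordered list $(B_1,\dots,B_k)$ of pairwise disjoint nonempty subsets (blocks) of $[n]$ whose union is $[n]$, written $B_1/B_2/\cdots/B_k$. A parking function of length $n$ is $\alpha=(a_1,\dots,a_n)\in[n]^n$ such that, when cars $1,\dots,n$ arrive in order on a one-way street with spots $1,\dots,n$ and car $i$ parks in the first unoccupied spot $\ge a_i$, every car parks. Car $i$'s displacement is (spot it parks in) $-a_i$; a unit-interval parking function is one in which every car has displacement at most $1$. $\alpha$ has a breakpoint at $k$ if $|\{i:a_i\le k\}|=k$. *)

theory Defs
  imports Main "HOL-Library.FuncSet" "HOL-Library.Disjoint_Sets"
begin

definition ordered_set_partitions :: "nat \<Rightarrow> nat set list set" where
  "ordered_set_partitions n = {Bs. distinct Bs \<and> partition_on {1..n} (set Bs)}"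

text \<open>
  A preference vector in \<open>[n]\<^sup>n\<close> is an element of \<open>{1..n} \<rightarrow>\<^sub>E {1..n}\<close>, so that equality of
  vectors is equality of functions; cars and spots are numbered from 1.
\<close>

definition first_free :: "nat \<Rightarrow> nat set \<Rightarrow> nat \<Rightarrow> nat option" where
  "first_free n occ p =
     (if {p..n} - occ = {} then None else Some (Min ({p..n} - occ)))"

text \<open>\<open>occupied n \<alpha> i\<close> is the set of spots taken once cars \<open>1, \<dots>, i\<close> have arrived; a car that
  finds no free spot leaves the street.\<close>

primrec occupied :: "nat \<Rightarrow> (nat \<Rightarrow> nat) \<Rightarrow> nat \<Rightarrow> nat set" where
  "occupied n \<alpha> 0 = {}"
| "occupied n \<alpha> (Suc i) =
     occupied n \<alpha> i \<union> set_option (first_free n (occupied n \<alpha> i) (\<alpha> (Suc i)))"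

definition spot :: "nat \<Rightarrow> (nat \<Rightarrow> nat) \<Rightarrow> nat \<Rightarrow> nat option" where
  "spot n \<alpha> i = first_free n (occupied n \<alpha> (i - 1)) (\<alpha> i)"

definition parking_functions :: "nat \<Rightarrow> (nat \<Rightarrow> nat) set" where
  "parking_functions n =
     {\<alpha> \<in> {1..n} \<rightarrow>\<^sub>E {1..n}. \<forall>i\<in>{1..n}. spot n \<alpha> i \<noteq> None}"

text \<open>The subtraction never truncates, since a car parks at or after its preferred spot.\<close>

definition displacement :: "nat \<Rightarrow> (nat \<Rightarrow> nat) \<Rightarrow> nat \<Rightarrow> nat" where
  "displacement n \<alpha> i = the (spot n \<alpha> i) - \<alpha> i"

definition UPF :: "nat \<Rightarrow> (nat \<Rightarrow> nat) set" where
  "UPF n = {\<alpha> \<in> parking_functions n. \<forall>i\<in>{1..n}. displacement n \<alpha> i \<le> 1}"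

definition breakpoints :: "nat \<Rightarrow> (nat \<Rightarrow> nat) \<Rightarrow> nat set" where
  "breakpoints n \<alpha> = {k \<in> {1..n}. card {i \<in> {1..n}. \<alpha> i \<le> k} = k}"

definition car_in_spot :: "nat \<Rightarrow> (nat \<Rightarrow> nat) \<Rightarrow> nat \<Rightarrow> nat" where
  "car_in_spot n \<alpha> j = (THE i. i \<in> {1..n} \<and> spot n \<alpha> i = Some j)"

text \<open>In \<open>psi\<close>, \<open>a\<close> is the (0-based) position of the block containing the car \<open>c\<close>, and \<open>t\<close> is the
  (1-based) position of \<open>c\<close> in the increasing enumeration of that block.\<close>

definition psi :: "nat \<Rightarrow> nat set list \<Rightarrow> (nat \<Rightarrow> nat)" where
  "psi n Bs = (\<lambda>c\<in>{1..n}.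
     let a = (THE a. a < length Bs \<and> c \<in> Bs ! a);
         s = (\<Sum>b<a. card (Bs ! b));
         t = (THE t. t \<in> {1..card (Bs ! a)} \<and> sorted_list_of_set (Bs ! a) ! (t - 1) = c)
     in if t = 1 then s + 1 else s + t - 1)"

text \<open>In \<open>phi\<close>, the list \<open>b\<close> is \<open>[b\<^sub>0, b\<^sub>1, \<dots>, b\<^sub>k]\<close> with \<open>b\<^sub>0 = 0\<close>.\<close>

definition phi :: "nat \<Rightarrow> (nat \<Rightarrow> nat) \<Rightarrow> nat set list" where
  "phi n \<alpha> =
     (let b = 0 # sorted_list_of_set (breakpoints n \<alpha>)
      in map (\<lambda>t. car_in_spot n \<alpha> ` {b ! t <.. b ! Suc t}) [0..<length b - 1])"

end

theory Submission
  imports Defs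
begin

text \<open>
  A unit-interval parking function is determined by its parking outcome together with the set of
  lucky spots, i.e. those whose car obtains its preference. A car displaced into spot \<open>k + 1\<close>
  preferred spot \<open>k\<close>, so \<open>k < n\<close> is a breakpoint iff spot \<open>k + 1\<close> is lucky. Hence the breakpoints
  cut the street into runs consisting of a lucky spot followed by unlucky ones, and along such a run
  each car arrives after its left neighbour. The outcome on a run is therefore the increasing
  enumeration of the set of its cars, and the sequence of these sets carries all the information.
\<close>

section \<open>Outcomes of unit-interval parking\<close>

locale unit_parking =
  fixes n :: nat and \<alpha> p :: "nat \<Rightarrow> nat"
  assumes pref: "\<alpha> \<in> {1..n} \<rightarrow>\<^sub>E {1..n}"
    and bij: "bij_betw p {1..n} {1..n}"
    and pref_le: "i \<in> {1..n} \<Longrightarrow> \<alpha> i \<le> p i"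
    and le_Suc_pref: "i \<in> {1..n} \<Longrightarrow> p i \<le> Suc (\<alpha> i)"
    and displaced: "i \<in> {1..n} \<Longrightarrow> \<alpha> i < p i \<Longrightarrow> \<alpha> i \<in> p ` {1..<i}"
begin

text \<open>Turns the locale's static conditions on a candidate outcome \<open>p\<close> into the
  parking process. Injectivity keeps \<open>p i\<close> free of earlier cars. A smaller free spot
  from \<open>\<alpha> i\<close> on could only be \<open>\<alpha> i\<close> itself, since the
  displacement is at most 1, and \<open>displaced\<close> says that one is taken.\<close>

lemma first_free_eq:
  assumes "i \<in> {1..n}"
  shows "first_free n (p ` {1..<i}) (\<alpha> i) = Some (p i)"
proof -
  have free: "p i \<in> {\<alpha> i..n} - p ` {1..<i}"
  proof -
    have "p i \<le> n" using bij_betwE[OF bij] assms by auto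
    moreover have "p i \<noteq> p j" if "j \<in> {1..<i}" for j
      using inj_onD[OF bij_betw_imp_inj_on[OF bij], of i j] assms that by auto
    ultimately show ?thesis using pref_le[OF assms] by (metis DiffI atLeastAtMost_iff imageE)
  qed
  have "Min ({\<alpha> i..n} - p ` {1..<i}) = p i"
  proof (rule Min_eqI)
    fix j assume j: "j \<in> {\<alpha> i..n} - p ` {1..<i}"
    show "p i \<le> j"
    proof (rule ccontr)
      assume "\<not> p i \<le> j"
      with j le_Suc_pref[OF assms] have "j = \<alpha> i" "\<alpha> i < p i" by auto
      with displaced[OF assms] j show False by auto
    qed
  qed (use free in auto)
  with free show ?thesis by (auto simp: first_free_def)
qed

lemma occupied_eq: "i \<le> n \<Longrightarrow> occupied n \<alpha> i = p ` {1..i}"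
proof (induction i)
  case (Suc i)
  have "{1..<Suc i} = {1..i}" by auto
  with Suc first_free_eq[of "Suc i"] show ?case
    by (auto simp: atLeastAtMostSuc_conv)
qed simp

lemma spot_eq:
  assumes "i \<in> {1..n}"
  shows "spot n \<alpha> i = Some (p i)"
proof -
  have "{1..i - 1} = {1..<i}" using assms by auto
  with assms show ?thesis
    using occupied_eq[of "i - 1"] first_free_eq[OF assms] by (auto simp: spot_def)
qed

lemma UPF: "\<alpha> \<in> UPF n"
  using pref le_Suc_pref spot_eq
  by (fastforce simp: UPF_def parking_functions_def displacement_def)

lemma car_in_spot_eq:
  assumes "i \<in> {1..n}"
  shows "car_in_spot n \<alpha> (p i) = i"
  unfolding car_in_spot_def
proof (rule the_equality)
  show "i \<in> {1..n} \<and> spot n \<alpha> i = Some (p i)" using assms spot_eq by auto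
next
  fix j assume "j \<in> {1..n} \<and> spot n \<alpha> j = Some (p i)"
  with spot_eq[of j] have "j \<in> {1..n}" "p j = p i" by auto
  with assms show "j = i" using inj_onD[OF bij_betw_imp_inj_on[OF bij]] by blast
qed

lemma
  assumes "j \<in> {1..n}"
  shows car_in_spot_mem: "car_in_spot n \<alpha> j \<in> {1..n}"
    and spot_car: "p (car_in_spot n \<alpha> j) = j"
proof -
  from assms bij obtain i where i: "i \<in> {1..n}" "p i = j"
    unfolding bij_betw_def by (metis imageE)
  have "car_in_spot n \<alpha> j = i" using car_in_spot_eq[OF i(1)] unfolding i(2) .
  with i show "car_in_spot n \<alpha> j \<in> {1..n}" "p (car_in_spot n \<alpha> j) = j"
    by (simp_all only:)
qed

lemma car_in_spot_inj: "inj_on (car_in_spot n \<alpha>) {1..n}"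
  by (rule inj_on_inverseI[of _ p]) (rule spot_car)

lemma car_in_spot_image: "car_in_spot n \<alpha> ` {1..n} = {1..n}"
  by (rule endo_inj_surj) (use car_in_spot_inj car_in_spot_mem in auto)

text \<open>For \<open>k < n\<close>, the cars preferring a spot up to \<open>k\<close> are the
  \<open>k\<close> cars parked there and possibly the one in spot \<open>k + 1\<close>; cars parked
  further on prefer spots beyond \<open>k\<close>. So the count is \<open>k\<close> exactly when the
  car in spot \<open>k + 1\<close> is not displaced.\<close>

lemma breakpoint_iff:
  assumes "k \<in> {1..n}"
  shows "k \<in> breakpoints n \<alpha> \<longleftrightarrow> k = n \<or> \<alpha> (car_in_spot n \<alpha> (Suc k)) = Suc k"
proof (cases "k = n")
  case True
  have "{i \<in> {1..n}. \<alpha> i \<le> n} = {1..n}" using pref by auto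
  with True assms show ?thesis by (auto simp: breakpoints_def)
next
  case False
  let ?\<sigma> = "car_in_spot n \<alpha>"
  let ?c = "?\<sigma> (Suc k)"
  have k: "Suc k \<in> {1..n}" using assms False by auto
  have c: "?c \<in> {1..n}" "p ?c = Suc k" using car_in_spot_mem[OF k] spot_car[OF k] by auto
  have sub: "?\<sigma> ` {1..k} \<subseteq> {1..n}" using car_in_spot_mem assms by fastforce
  have spots: "p i \<le> k" if "i \<in> ?\<sigma> ` {1..k}" for i
    using that spot_car assms by auto
  have mem: "i \<in> ?\<sigma> ` {1..k} \<longleftrightarrow> p i \<le> k" if "i \<in> {1..n}" for i
  proof
    assume "p i \<le> k"
    moreover have "p i \<in> {1..n}" using bij that by (auto simp: bij_betw_def)
    ultimately show "i \<in> ?\<sigma> ` {1..k}" using car_in_spot_eq[OF that]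
      by (metis atLeastAtMost_iff imageI)
  qed (rule spots)
  have card: "card (?\<sigma> ` {1..k}) = k"
    using card_image[OF inj_on_subset[OF car_in_spot_inj, of "{1..k}"]] assms by auto
  have eq: "{i \<in> {1..n}. \<alpha> i \<le> k} = ?\<sigma> ` {1..k} \<union> (if \<alpha> ?c \<le> k then {?c} else {})"
  proof (intro set_eqI iffI)
    fix i assume "i \<in> {i \<in> {1..n}. \<alpha> i \<le> k}"
    then have i: "i \<in> {1..n}" "\<alpha> i \<le> k" by auto
    show "i \<in> ?\<sigma> ` {1..k} \<union> (if \<alpha> ?c \<le> k then {?c} else {})"
    proof (cases "p i \<le> k")
      case True then show ?thesis using mem i by auto
    next
      case False
      then have "p i = Suc k" using le_Suc_pref[OF i(1)] i by auto
      then have "i = ?c" using car_in_spot_eq[OF i(1)] by auto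
      then show ?thesis using i by auto
    qed
  next
    fix i assume i: "i \<in> ?\<sigma> ` {1..k} \<union> (if \<alpha> ?c \<le> k then {?c} else {})"
    show "i \<in> {i \<in> {1..n}. \<alpha> i \<le> k}"
    proof (cases "i \<in> ?\<sigma> ` {1..k}")
      case True
      with sub have "i \<in> {1..n}" by blast
      with mem[of i] True pref_le[of i] show ?thesis by auto
    qed (use i c in \<open>auto split: if_splits\<close>)
  qed
  have "?c \<notin> ?\<sigma> ` {1..k}" using mem c by auto
  then have "card {i \<in> {1..n}. \<alpha> i \<le> k} = (if \<alpha> ?c \<le> k then Suc k else k)"
    unfolding eq using card by auto
  moreover have "\<alpha> ?c \<le> Suc k" using pref_le c by metis
  ultimately show ?thesis using assms False by (auto simp: breakpoints_def)
qed

end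

text \<open>Converse of \<open>UPF\<close>: the real outcome satisfies the locale, so everything
  proved there applies to every element of \<open>UPF n\<close>.\<close>

lemma UPF_imp_unit_parking:
  assumes "\<alpha> \<in> UPF n"
  shows "unit_parking n \<alpha> (\<lambda>i. the (spot n \<alpha> i))"
proof -
  define p where "p i = the (spot n \<alpha> i)" for i
  have spot: "spot n \<alpha> i = Some (p i)"
    and disp: "p i - \<alpha> i \<le> 1" if "i \<in> {1..n}" for i
    using assms that by (auto simp: UPF_def parking_functions_def p_def displacement_def)
  have pref: "\<alpha> \<in> {1..n} \<rightarrow>\<^sub>E {1..n}"
    using assms by (auto simp: UPF_def parking_functions_def)
  have occ: "i \<le> n \<Longrightarrow> occupied n \<alpha> i = p ` {1..i}" for i
  proof (induction i)
    case (Suc i)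
    with spot[of "Suc i"] show ?case
      by (auto simp: spot_def atLeastAtMostSuc_conv)
  qed simp
  have free: "p i \<in> {\<alpha> i..n} - p ` {1..<i}"
    and least: "\<And>j. j \<in> {\<alpha> i..n} - p ` {1..<i} \<Longrightarrow> p i \<le> j" if "i \<in> {1..n}" for i
  proof -
    let ?F = "{\<alpha> i..n} - p ` {1..<i}"
    have "{1..i - 1} = {1..<i}" using that by auto
    then have "first_free n (p ` {1..<i}) (\<alpha> i) = Some (p i)"
      using spot[OF that] occ[of "i - 1"] that by (auto simp: spot_def)
    then have "?F \<noteq> {}" "p i = Min ?F" by (auto simp: first_free_def split: if_splits)
    then show "p i \<in> ?F" "\<And>j. j \<in> ?F \<Longrightarrow> p i \<le> j"
      using Min_in[of ?F] by auto
  qed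
  \<comment> \<open>A later car parks in a spot that is still free, hence in none used by an earlier
    car.\<close>
  have inj: "inj_on p {1..n}"
  proof (rule linorder_inj_onI)
    fix i j assume "i < j" "i \<in> {1..n}" "j \<in> {1..n}"
    then have "p i \<in> p ` {1..<j}" by auto
    with free[OF \<open>j \<in> {1..n}\<close>] show "p i \<noteq> p j" by auto
  qed auto
  have mem: "p ` {1..n} \<subseteq> {1..n}"
  proof
    fix x assume "x \<in> p ` {1..n}"
    then obtain i where i: "i \<in> {1..n}" "x = p i" by auto
    have "\<alpha> i \<in> {1..n}" using pref i by auto
    with free[OF i(1)] i show "x \<in> {1..n}" by auto
  qed
  have "unit_parking n \<alpha> p"
  proof
    show "bij_betw p {1..n} {1..n}"
      using endo_inj_surj[OF _ mem inj] inj by (auto simp: bij_betw_def)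
  next
    fix i assume i: "i \<in> {1..n}"
    show "\<alpha> i \<le> p i" using free[OF i] by auto
    show "p i \<le> Suc (\<alpha> i)" using disp[OF i] by auto
    assume "\<alpha> i < p i"
    moreover have "\<alpha> i \<in> {1..n}" using pref i by auto
    \<comment> \<open>Were the preferred spot free, minimality of \<open>p i\<close> would give
      \<open>p i \<le> \<alpha> i\<close>.\<close>
    ultimately show "\<alpha> i \<in> p ` {1..<i}" using least[OF i, of "\<alpha> i"] by force
  qed (rule pref)
  then show ?thesis by (simp add: p_def[abs_def])
qed

section \<open>Ordered set partitions and the map \<open>psi\<close>\<close>

lemma ex1_nth_of_disjoint_blocks:
  assumes "distinct Bs" "disjoint (set Bs)" "c \<in> \<Union> (set Bs)"
  shows "\<exists>!a. a < length Bs \<and> c \<in> Bs ! a"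
proof -
  from assms(3) obtain a where a: "a < length Bs" "c \<in> Bs ! a"
    by (metis UnionE in_set_conv_nth)
  have "a' = a" if "a' < length Bs" "c \<in> Bs ! a'" for a'
    using disjointD[OF assms(2), of "Bs ! a'" "Bs ! a"] a that
      nth_eq_iff_index_eq[OF assms(1)] by (metis disjoint_iff nth_mem)
  with a show ?thesis by blast
qed

text \<open>Trades both definite descriptions in \<open>psi\<close> for known indices. The rank
  \<open>t\<close> counts from 0 here and from 1 in \<open>psi\<close>, so the offset of a later car
  is \<open>t\<close> instead of \<open>t - 1\<close>.\<close>

lemma psi_eq:
  assumes "distinct Bs" "disjoint (set Bs)" "a < length Bs" "t < card (Bs ! a)"
    and "sorted_list_of_set (Bs ! a) ! t = c" "c \<in> {1..n}"
  shows "psi n Bs c = (\<Sum>b<a. card (Bs ! b)) + (if t = 0 then 1 else t)"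
proof -
  have fin: "finite (Bs ! a)" using assms(4) card.infinite by fastforce
  let ?l = "sorted_list_of_set (Bs ! a)"
  have len: "length ?l = card (Bs ! a)" by simp
  have c: "c \<in> Bs ! a" using assms(4,5) fin len nth_mem set_sorted_list_of_set by metis
  have "c \<in> \<Union> (set Bs)" using c assms(3) nth_mem by blast
  from ex1_nth_of_disjoint_blocks[OF assms(1,2) this]
  have a: "(THE a. a < length Bs \<and> c \<in> Bs ! a) = a"
    using assms(3) c by blast
  have t: "(THE t. t \<in> {1..card (Bs ! a)} \<and> ?l ! (t - 1) = c) = Suc t"
  proof (rule the_equality)
    fix u assume u: "u \<in> {1..card (Bs ! a)} \<and> ?l ! (u - 1) = c"
    then have "?l ! (u - 1) = ?l ! t" using assms(5) by metis
    moreover have "u - 1 < length ?l" "t < length ?l" using u assms(4) len by auto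
    ultimately have "u - 1 = t"
      using nth_eq_iff_index_eq[OF sorted_list_of_set.distinct_sorted_key_list_of_set] by blast
    with u show "u = Suc t" by auto
  qed (use assms in auto)
  show ?thesis unfolding psi_def restrict_apply'[OF assms(6)] Let_def a t by simp
qed

text \<open>Bounded by \<open>m\<close> because it serves partial sums over a list, whose entries
  are unspecified past its end.\<close>

lemma less_of_less_Suc_below:
  fixes S :: "nat \<Rightarrow> nat"
  assumes "\<And>a. a < m \<Longrightarrow> S a < S (Suc a)"
  shows "a < b \<Longrightarrow> b \<le> m \<Longrightarrow> S a < S b"
proof (induction b)
  case (Suc b)
  with assms[of b] show ?case by (cases "a = b") auto
qed simp

locale ordered_partition =
  fixes n :: nat and Bs :: "nat set list"
  assumes osp: "Bs \<in> ordered_set_partitions n"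
begin

text \<open>Block \<open>a\<close> is meant to fill the run of spots
  \<open>{S a<..S (Suc a)}\<close>; the values at positive indices up to \<open>length Bs\<close>
  turn out to be the breakpoints.\<close>

definition S :: "nat \<Rightarrow> nat" where "S a = (\<Sum>b<a. card (Bs ! b))"

lemma dist: "distinct Bs" and disj: "disjoint (set Bs)" and union: "\<Union> (set Bs) = {1..n}"
  using osp by (auto simp: ordered_set_partitions_def partition_on_def)

lemma
  assumes "a < length Bs"
  shows block_subset: "Bs ! a \<subseteq> {1..n}" and finite_block: "finite (Bs ! a)"
    and card_block: "card (Bs ! a) > 0"
proof -
  show sub: "Bs ! a \<subseteq> {1..n}" using union assms nth_mem by blast
  then show fin: "finite (Bs ! a)" using finite_subset by blast
  have "Bs ! a \<noteq> {}"
    using osp nth_mem[OF assms] by (auto simp: ordered_set_partitions_def partition_on_def)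
  with fin show "card (Bs ! a) > 0" by auto
qed

lemma S_0 [simp]: "S 0 = 0" and S_Suc: "S (Suc a) = S a + card (Bs ! a)"
  by (auto simp: S_def)

lemma S_less: "a < b \<Longrightarrow> b \<le> length Bs \<Longrightarrow> S a < S b"
  by (rule less_of_less_Suc_below[of "length Bs"]) (use card_block in \<open>auto simp: S_Suc\<close>)

lemma S_le: "a \<le> b \<Longrightarrow> b \<le> length Bs \<Longrightarrow> S a \<le> S b"
  using S_less[of a b] by (cases "a = b") auto

lemma S_length: "S (length Bs) = n"
proof -
  have "S (length Bs) = (\<Sum>B\<in>set Bs. card B)"
    unfolding S_def
    using sum.reindex_bij_betw[OF bij_betw_nth[OF dist refl refl], of card] by simp
  also have "\<dots> = card (\<Union> (set Bs))"
    using disj finite_block by (intro card_Union_disjoint[symmetric])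
      (auto simp: disjoint_def pairwise_def disjnt_def in_set_conv_nth)
  also have "\<dots> = n" using union by simp
  finally show ?thesis .
qed

text \<open>Coordinates of a car: its block and its 0-based rank there. For cars in
  \<open>{1..n}\<close> the choice is forced, by \<open>place_exists\<close> and
  \<open>place_eq\<close>.\<close>

definition place :: "nat \<Rightarrow> nat \<times> nat" where
  "place c = (SOME (a, t). a < length Bs \<and> t < card (Bs ! a)
     \<and> sorted_list_of_set (Bs ! a) ! t = c)"

text \<open>The intended outcome of \<open>psi n Bs\<close>: blocks are laid along the street in
  order, each by increasing car number. Guessing it in advance avoids simulating the
  process.\<close>

definition p :: "nat \<Rightarrow> nat" where
  "p c = (case place c of (a, t) \<Rightarrow> S a + Suc t)"

lemma place_exists:
  assumes "c \<in> {1..n}"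
  obtains a t where "a < length Bs" "t < card (Bs ! a)" "sorted_list_of_set (Bs ! a) ! t = c"
proof -
  obtain a where a: "a < length Bs" "c \<in> Bs ! a"
    using ex1_nth_of_disjoint_blocks[OF dist disj] assms union by metis
  then have "c \<in> set (sorted_list_of_set (Bs ! a))" using finite_block by simp
  then obtain t where "t < length (sorted_list_of_set (Bs ! a))"
    "sorted_list_of_set (Bs ! a) ! t = c" by (metis in_set_conv_nth)
  with a that show ?thesis by auto
qed

lemma nth_mem_block:
  assumes "a < length Bs" "t < card (Bs ! a)"
  shows "sorted_list_of_set (Bs ! a) ! t \<in> Bs ! a"
  using assms finite_block nth_mem[of t "sorted_list_of_set (Bs ! a)"] by simp

lemma place_eq:
  assumes "a < length Bs" "t < card (Bs ! a)" "sorted_list_of_set (Bs ! a) ! t = c"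
  shows "place c = (a, t)"
  unfolding place_def
proof (rule some_equality)
  fix x assume x: "case x of (a, t) \<Rightarrow> a < length Bs \<and> t < card (Bs ! a)
     \<and> sorted_list_of_set (Bs ! a) ! t = c"
  obtain a' t' where [simp]: "x = (a', t')" by (cases x)
  have "c \<in> Bs ! a" "c \<in> Bs ! a'"
    using nth_mem_block[of a t] nth_mem_block[of a' t'] assms x by auto
  moreover have "c \<in> \<Union> (set Bs)" using \<open>c \<in> Bs ! a\<close> assms(1) nth_mem by blast
  ultimately have "a' = a"
    using ex1_nth_of_disjoint_blocks[OF dist disj] assms(1) x by auto
  moreover have "t' = t"
    using nth_eq_iff_index_eq[of "sorted_list_of_set (Bs ! a)" t' t] assms x \<open>a' = a\<close> by auto
  ultimately show "x = (a, t)" by simp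
qed (use assms in simp)

lemma p_eq:
  assumes "a < length Bs" "t < card (Bs ! a)"
  shows "p (sorted_list_of_set (Bs ! a) ! t) = S a + Suc t"
  by (simp add: p_def place_eq[OF assms refl])

lemma psi_nth:
  assumes "a < length Bs" "t < card (Bs ! a)"
  shows "psi n Bs (sorted_list_of_set (Bs ! a) ! t) = S a + (if t = 0 then 1 else t)"
  using psi_eq[OF dist disj assms refl] nth_mem_block[OF assms] block_subset[OF assms(1)]
  by (auto simp: S_def)

lemma p_in_run:
  assumes "a < length Bs" "c \<in> Bs ! a"
  shows "p c \<in> {S a<..S (Suc a)}"
proof -
  have "c \<in> set (sorted_list_of_set (Bs ! a))" using assms finite_block by simp
  then obtain t where "t < card (Bs ! a)" "sorted_list_of_set (Bs ! a) ! t = c"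
    by (metis in_set_conv_nth length_sorted_list_of_set)
  with p_eq[OF assms(1)] show ?thesis by (auto simp: S_Suc)
qed

lemma run_unique:
  assumes "a < length Bs" "b < length Bs" "x \<in> {S a<..S (Suc a)}" "x \<in> {S b<..S (Suc b)}"
  shows "a = b"
  using assms S_le[of "Suc a" b] S_le[of "Suc b" a] by (cases a b rule: linorder_cases) auto

text \<open>Different blocks use disjoint runs, and inside a run the spot determines the rank.
  Surjectivity then follows by finiteness.\<close>

lemma p_bij: "bij_betw p {1..n} {1..n}"
proof -
  have inj: "inj_on p {1..n}"
  proof (rule inj_onI)
    fix c d assume "c \<in> {1..n}" "d \<in> {1..n}" and eq: "p c = p d"
    then obtain a t b u where c: "a < length Bs" "t < card (Bs ! a)"
        "sorted_list_of_set (Bs ! a) ! t = c"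
      and d: "b < length Bs" "u < card (Bs ! b)" "sorted_list_of_set (Bs ! b) ! u = d"
      by (metis place_exists)
    have "p c = S a + Suc t" "p d = S b + Suc u" using p_eq c d by auto
    moreover from this have "a = b"
      using c d eq run_unique[of a b "p c"] by (auto simp: S_Suc)
    ultimately show "c = d" using eq c d by auto
  qed
  have "p ` {1..n} \<subseteq> {1..n}"
  proof
    fix x assume "x \<in> p ` {1..n}"
    then obtain c where c: "c \<in> {1..n}" "x = p c" by auto
    then obtain a where a: "a < length Bs" "c \<in> Bs ! a"
      using ex1_nth_of_disjoint_blocks[OF dist disj] union by metis
    with p_in_run[OF a] c S_le[of "Suc a" "length Bs"] S_length show "x \<in> {1..n}" by auto
  qed
  with inj show ?thesis using endo_inj_surj[of "{1..n}" p] by (auto simp: bij_betw_def)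
qed

text \<open>The first car of a block prefers its own spot in \<open>p\<close>; any other prefers the
  spot of its predecessor in the block, which has a smaller number and so arrives earlier. This is
  \<open>displaced\<close>, and with it \<open>UPF\<close> makes \<open>psi\<close> well
  defined.\<close>

sublocale unit_parking n "psi n Bs" p
proof
  have rng: "psi n Bs c \<in> {1..n} \<and> psi n Bs c \<le> p c \<and> p c \<le> Suc (psi n Bs c) \<and>
    (psi n Bs c < p c \<longrightarrow> psi n Bs c \<in> p ` {1..<c})" if "c \<in> {1..n}" for c
  proof -
    from place_exists[OF that] obtain a t where
      c: "a < length Bs" "t < card (Bs ! a)" "sorted_list_of_set (Bs ! a) ! t = c" .
    have p: "p c = S a + Suc t" and psi: "psi n Bs c = S a + (if t = 0 then 1 else t)"
      using p_eq psi_nth c by auto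
    have "p c \<in> {1..n}" using p_bij that by (auto simp: bij_betw_def)
    moreover have "psi n Bs c \<in> p ` {1..<c}" if "t \<noteq> 0"
    proof -
      let ?d = "sorted_list_of_set (Bs ! a) ! (t - 1)"
      have t: "t - 1 < card (Bs ! a)" using c by auto
      have "?d < c"
        using c \<open>t \<noteq> 0\<close> sorted_wrt_nth_less[OF strict_sorted_list_of_set, of "t - 1" t "Bs ! a"]
        by auto
      moreover have "?d \<in> {1..n}" using nth_mem_block[OF c(1) t] block_subset[OF c(1)] by auto
      moreover have "p ?d = psi n Bs c" using p_eq[OF c(1) t] psi that by auto
      ultimately show ?thesis by (intro image_eqI[of _ _ ?d]) auto
    qed
    ultimately show ?thesis using p psi by auto
  qed
  show "psi n Bs \<in> {1..n} \<rightarrow>\<^sub>E {1..n}" 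
  proof (rule PiE_I)
    \<comment> \<open>The extensional function space fixes the value off \<open>{1..n}\<close>, and
      \<open>restrict\<close> supplies the same default.\<close>
    show "psi n Bs c = undefined" if "c \<notin> {1..n}" for c
      unfolding psi_def by (rule restrict_apply[THEN trans, OF if_not_P[OF that]])
  qed (use rng in blast)
  show "psi n Bs i \<le> p i" "p i \<le> Suc (psi n Bs i)" if "i \<in> {1..n}" for i
    using rng[OF that] by - (elim conjE, assumption)+
  show "psi n Bs i \<in> p ` {1..<i}" if "i \<in> {1..n}" "psi n Bs i < p i" for i
    using rng[OF that(1)] that(2) by (elim conjE) (erule (1) mp)
qed (rule p_bij)

text \<open>The lucky cars are those of rank 0, and they sit in the spots just after the partial
  sums.\<close>

lemma lucky_iff:
  assumes "k < n"
  shows "psi n Bs (car_in_spot n (psi n Bs) (Suc k)) = Suc k \<longleftrightarrow> (\<exists>a<length Bs. k = S a)"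
proof -
  let ?c = "car_in_spot n (psi n Bs) (Suc k)"
  have c: "?c \<in> {1..n}" "p ?c = Suc k" using car_in_spot_mem spot_car assms by auto
  from place_exists[OF c(1)] obtain a t where
    at: "a < length Bs" "t < card (Bs ! a)" "sorted_list_of_set (Bs ! a) ! t = ?c" .
  have k: "Suc k = S a + Suc t" "psi n Bs ?c = S a + (if t = 0 then 1 else t)"
    using p_eq[OF at(1,2)] psi_nth[OF at(1,2)] at(3) c by auto
  \<comment> \<open>Spot \<open>k + 1\<close> is then the first spot of run \<open>b\<close> and
    also lies in run \<open>a\<close>; distinct runs are disjoint.\<close>
  have "t = 0" if "b < length Bs" "k = S b" for b
  proof -
    have "b = a"
      using run_unique[of b a "Suc k"] that at k S_less[of b "Suc b"] by (auto simp: S_Suc)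
    with k that show ?thesis by auto
  qed
  then have "(\<exists>a<length Bs. k = S a) \<longleftrightarrow> t = 0" using k(1) at(1) by auto
  moreover have "psi n Bs ?c = Suc k \<longleftrightarrow> t = 0" using k by (cases "t = 0") presburger+
  ultimately show ?thesis by blast
qed

text \<open>Below \<open>n\<close> this combines \<open>breakpoint_iff\<close> with
  \<open>lucky_iff\<close>, where index 0 drops out because breakpoints are positive;
  \<open>n\<close> itself is the last partial sum.\<close>

lemma breakpoints_psi: "breakpoints n (psi n Bs) = S ` {1..length Bs}"
proof (intro set_eqI iffI)
  fix k assume k: "k \<in> breakpoints n (psi n Bs)"
  then have k1: "k \<in> {1..n}" by (auto simp: breakpoints_def)
  show "k \<in> S ` {1..length Bs}"
  proof (cases "k = n")
    case True
    then have "length Bs \<noteq> 0" using k1 S_length S_0 by (metis atLeastAtMost_iff not_one_le_zero)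
    with True S_length show ?thesis by (intro image_eqI[of _ _ "length Bs"]) (auto simp: Suc_le_eq)
  next
    case False
    with breakpoint_iff[OF k1] k k1 lucky_iff[of k] obtain a where "a < length Bs" "k = S a"
      by auto
    moreover from this k1 have "a \<noteq> 0" by (intro notI) auto
    ultimately show ?thesis by auto
  qed
next
  fix k assume "k \<in> S ` {1..length Bs}"
  then obtain a where a: "a \<in> {1..length Bs}" "k = S a" by auto
  have k: "k \<in> {1..n}" using a S_less[of 0 a] S_le[of a "length Bs"] S_length by auto
  show "k \<in> breakpoints n (psi n Bs)"
  proof (cases "a = length Bs")
    case True then show ?thesis using breakpoint_iff[OF k] a S_length by auto
  next
    case False
    then have "k < n" using a S_less[of a "length Bs"] S_length by auto
    moreover have "a < length Bs" using a False by auto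
    ultimately show ?thesis using lucky_iff[of k] breakpoint_iff[OF k] a(2) by blast
  qed
qed

text \<open>A car parked in run \<open>a\<close> belongs to some block, whose run contains the same
  spot; since runs are disjoint that block is \<open>Bs ! a\<close>.\<close>

lemma cars_in_run:
  assumes "a < length Bs"
  shows "car_in_spot n (psi n Bs) ` {S a<..S (Suc a)} = Bs ! a"
proof (intro set_eqI iffI)
  fix c assume "c \<in> Bs ! a"
  then have "c \<in> {1..n}" "p c \<in> {S a<..S (Suc a)}"
    using block_subset[OF assms] p_in_run[OF assms] by blast+
  then show "c \<in> car_in_spot n (psi n Bs) ` {S a<..S (Suc a)}"
    using car_in_spot_eq by (metis imageI)
next
  fix c assume "c \<in> car_in_spot n (psi n Bs) ` {S a<..S (Suc a)}"
  then obtain j where j: "j \<in> {S a<..S (Suc a)}" "c = car_in_spot n (psi n Bs) j" by auto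
  then have "j \<in> {1..n}" using S_le[of "Suc a" "length Bs"] S_length assms by auto
  then have c: "c \<in> {1..n}" "p c = j" using car_in_spot_mem spot_car j by auto
  then obtain b where b: "b < length Bs" "c \<in> Bs ! b"
    using ex1_nth_of_disjoint_blocks[OF dist disj] union by metis
  with run_unique[OF assms b(1) j(1)] p_in_run[OF b] c show "c \<in> Bs ! a" by auto
qed

text \<open>Strict growth of \<open>S\<close> means its values are already the sorted breakpoints,
  and the leading 0 in \<open>phi\<close> is \<open>S 0\<close>. Hence \<open>phi\<close> cuts the
  street into the original runs.\<close>

lemma phi_psi: "phi n (psi n Bs) = Bs"
proof -
  let ?l = "map S [1..<Suc (length Bs)]"
  have "sorted_wrt (<) ?l"
    by (auto simp: sorted_wrt_iff_nth_less simp del: upt_Suc intro!: S_less)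
  then have "sorted_list_of_set (set ?l) = ?l"
    by (intro sorted_list_of_set.idem_if_sorted_distinct) (auto simp: strict_sorted_iff)
  moreover have "set ?l = breakpoints n (psi n Bs)" by (auto simp: breakpoints_psi)
  ultimately have "0 # sorted_list_of_set (breakpoints n (psi n Bs)) = map S [0..<Suc (length Bs)]"
    by (simp add: upt_conv_Cons del: upt_Suc)
  then have "phi n (psi n Bs) =
      map (\<lambda>t. car_in_spot n (psi n Bs) ` {S t<..S (Suc t)}) [0..<length Bs]"
    by (auto simp: phi_def Let_def nth_append simp del: upt_Suc)
  also have "\<dots> = Bs" by (rule nth_equalityI) (auto simp: cars_in_run)
  finally show ?thesis .
qed

end

section \<open>Runs between breakpoints and the map \<open>phi\<close>\<close>

context unit_parking
begin

definition b :: "nat list" where "b = 0 # sorted_list_of_set (breakpoints n \<alpha>)"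

abbreviation block :: "nat \<Rightarrow> nat set" where
  "block a \<equiv> car_in_spot n \<alpha> ` {b ! a<..b ! Suc a}"

lemma finite_breakpoints: "finite (breakpoints n \<alpha>)"
  by (auto simp: breakpoints_def)

lemma set_b: "set b = insert 0 (breakpoints n \<alpha>)"
  by (simp add: b_def finite_breakpoints)

lemma b_less: "i < j \<Longrightarrow> j < length b \<Longrightarrow> b ! i < b ! j"
  by (rule sorted_wrt_nth_less[of "(<)"])
    (auto simp: b_def finite_breakpoints breakpoints_def)

lemma b_le: "i \<le> j \<Longrightarrow> j < length b \<Longrightarrow> b ! i \<le> b ! j"
  using b_less[of i j] by (cases "i = j") auto

lemma b_le_n: "i < length b \<Longrightarrow> b ! i \<le> n"
  using nth_mem[of i b] unfolding set_b by (auto simp: breakpoints_def)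

text \<open>Ensures that the runs reach the end of the street; for \<open>n = 0\<close> the leading
  0 serves.\<close>

lemma n_in_b: "n \<in> set b"
  unfolding set_b using breakpoint_iff[of n] by (cases "n = 0") auto

lemma ex_run:
  assumes "j \<in> {1..n}"
  obtains a where "Suc a < length b" "j \<in> {b ! a<..b ! Suc a}"
proof -
  let ?P = "\<lambda>u. u < length b \<and> j \<le> b ! u"
  have ex: "\<exists>u. ?P u" using n_in_b assms by (metis atLeastAtMost_iff in_set_conv_nth)
  \<comment> \<open>The first cut at or beyond \<open>j\<close>. It is not entry 0, which is 0, and
    its predecessor lies below \<open>j\<close>, so \<open>j\<close> is in the run between
    them.\<close>
  define u where "u = (LEAST u. ?P u)"
  have u: "?P u" unfolding u_def using ex by (rule LeastI_ex)
  have "u \<noteq> 0" using u assms by (intro notI) (auto simp: b_def)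
  then obtain a where a: "u = Suc a" by (cases u) auto
  have "\<not> ?P a" using not_less_Least[of a ?P] a by (auto simp: u_def)
  with u a that show ?thesis by auto
qed

lemma run_subset: "Suc a < length b \<Longrightarrow> {b ! a<..b ! Suc a} \<subseteq> {1..n}"
  using b_le_n by fastforce

lemma phi_eq: "phi n \<alpha> = map block [0..<length b - 1]"
  by (simp add: phi_def b_def Let_def)

lemma mem_set_phiE:
  assumes "A \<in> set (phi n \<alpha>)"
  obtains a where "Suc a < length b" "A = block a"
proof -
  from assms obtain a where "a < length b - 1" "A = block a" unfolding phi_eq set_map by auto
  moreover from this(1) have "Suc a < length b" by auto
  ultimately show ?thesis using that by blast
qed

lemma block_disjoint:
  assumes "i < j" "Suc j < length b"
  shows "block i \<inter> block j = {}"
proof -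
  have "{b ! i<..b ! Suc i} \<inter> {b ! j<..b ! Suc j} = {}"
    using b_le[of "Suc i" j] assms by auto
  then show ?thesis
    using inj_on_image_Int[OF car_in_spot_inj run_subset run_subset, of i j] assms by auto
qed

lemma block_nonempty: "Suc a < length b \<Longrightarrow> block a \<noteq> {}"
  using b_less[of a "Suc a"] by auto

text \<open>The runs partition the street, and \<open>car_in_spot\<close> is a permutation of
  \<open>{1..n}\<close>, so its images of the runs partition the cars.\<close>

lemma phi_in: "phi n \<alpha> \<in> ordered_set_partitions n"
proof -
  have disj: "block i \<inter> block j = {}" if "i \<noteq> j" "Suc i < length b" "Suc j < length b" for i j
    using that block_disjoint[of i j] block_disjoint[of j i]
    by (cases i j rule: linorder_cases) auto
  have "distinct (phi n \<alpha>)"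
    unfolding phi_eq distinct_map
  proof (intro conjI inj_onI)
    fix i j assume "i \<in> set [0..<length b - 1]" "j \<in> set [0..<length b - 1]" "block i = block j"
    \<comment> \<open>Equal blocks at different positions would be disjoint from each other, hence
      empty.\<close>
    then show "i = j" using disj[of i j] block_nonempty[of j] by fastforce
  qed simp
  moreover have "\<Union> (set (phi n \<alpha>)) = {1..n}"
  proof -
    have "(\<Union>a\<in>{..<length b - 1}. {b ! a<..b ! Suc a}) = {1..n}"
    proof (intro equalityI subsetI)
      fix j assume "j \<in> {1..n}"
      then obtain a where "Suc a < length b" "j \<in> {b ! a<..b ! Suc a}" by (rule ex_run)
      then show "j \<in> (\<Union>a\<in>{..<length b - 1}. {b ! a<..b ! Suc a})" by (intro UN_I[of a]) auto
    next
      fix j assume "j \<in> (\<Union>a\<in>{..<length b - 1}. {b ! a<..b ! Suc a})"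
      then obtain a where "a < length b - 1" "j \<in> {b ! a<..b ! Suc a}" by auto
      moreover from this have "Suc a < length b" by auto
      ultimately show "j \<in> {1..n}" using run_subset by blast
    qed
    then have "(\<Union>a\<in>{..<length b - 1}. block a) = {1..n}"
      using car_in_spot_image by (metis image_UN)
    then show ?thesis by (simp add: phi_eq atLeast0LessThan)
  qed
  moreover have "disjoint (set (phi n \<alpha>))"
    unfolding disjoint_def
  proof (intro ballI impI)
    fix A B assume AB: "A \<in> set (phi n \<alpha>)" "B \<in> set (phi n \<alpha>)" "A \<noteq> B"
    obtain i where i: "Suc i < length b" "A = block i" using AB(1) by (rule mem_set_phiE)
    obtain j where j: "Suc j < length b" "B = block j" using AB(2) by (rule mem_set_phiE)
    have "i \<noteq> j" using AB(3) i j by blast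
    with disj i j show "A \<inter> B = {}" by blast
  qed
  moreover have "{} \<notin> set (phi n \<alpha>)"
  proof
    assume "{} \<in> set (phi n \<alpha>)"
    then obtain a where "Suc a < length b" "{} = block a" by (rule mem_set_phiE)
    with block_nonempty show False by metis
  qed
  ultimately show ?thesis by (auto simp: ordered_set_partitions_def partition_on_def)
qed

lemma lucky_first:
  assumes "Suc a < length b"
  shows "\<alpha> (car_in_spot n \<alpha> (Suc (b ! a))) = Suc (b ! a)"
proof -
  have less: "b ! a < n" using b_less[of a "Suc a"] b_le_n[of "Suc a"] assms by auto
  show ?thesis
  proof (cases "b ! a = 0")
    \<comment> \<open>Position 0 is a cut but never a breakpoint; here the car in spot 1 has no
      smaller spot to prefer.\<close>
    case True
    let ?c = "car_in_spot n \<alpha> 1"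
    have "?c \<in> {1..n}" "p ?c = 1" using car_in_spot_mem spot_car less by auto
    moreover from this have "\<alpha> ?c \<in> {1..n}" using pref by auto
    ultimately show ?thesis using pref_le[of ?c] True by auto
  next
    case False
    then have "b ! a \<in> breakpoints n \<alpha>" using nth_mem[of a b] assms by (auto simp: set_b)
    with breakpoint_iff[of "b ! a"] less False show ?thesis by auto
  qed
qed

text \<open>Inside a run there is no breakpoint, so spot \<open>k + 1\<close> is unlucky and its car
  preferred \<open>k\<close>. By \<open>displaced\<close> the car in spot \<open>k\<close> came
  first.\<close>

lemma displaced_later:
  assumes "Suc a < length b" "b ! a < k" "k < b ! Suc a"
  shows "\<alpha> (car_in_spot n \<alpha> (Suc k)) = k" "car_in_spot n \<alpha> k < car_in_spot n \<alpha> (Suc k)"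
proof -
  let ?c = "car_in_spot n \<alpha> (Suc k)"
  have k: "k \<in> {1..n}" "k < n" using assms b_le_n[of "Suc a"] by auto
  have "k \<notin> set b"
  proof
    assume "k \<in> set b"
    then obtain i where "i < length b" "b ! i = k" by (auto simp: in_set_conv_nth)
    with assms b_le[of i a] b_le[of "Suc a" i] show False by (cases "i \<le> a") auto
  qed
  then have "\<alpha> ?c \<noteq> Suc k" using breakpoint_iff[OF k(1)] by (auto simp: set_b)
  moreover have c: "?c \<in> {1..n}" "p ?c = Suc k" using car_in_spot_mem spot_car k by auto
  ultimately show \<alpha>: "\<alpha> ?c = k" using pref_le[of ?c] le_Suc_pref[of ?c] by auto
  with c displaced[of ?c] obtain d where "d \<in> {1..<?c}" "p d = k" by auto
  with car_in_spot_eq[of d] c show "car_in_spot n \<alpha> k < ?c" by auto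
qed

text \<open>Arrival order increases from each spot of a run to the next, hence along the whole run.
  So the mere set of cars recovers who parked where.\<close>

lemma sorted_block:
  assumes a: "Suc a < length b"
  shows "sorted_list_of_set (block a) = map (car_in_spot n \<alpha>) [Suc (b ! a)..<Suc (b ! Suc a)]"
proof -
  have mono: "j \<le> b ! Suc a \<Longrightarrow> b ! a < i \<Longrightarrow> i < j \<Longrightarrow> car_in_spot n \<alpha> i < car_in_spot n \<alpha> j" for i j
  proof (induction j)
    case (Suc j)
    with displaced_later(2)[OF a, of j] show ?case by (cases "i = j") auto
  qed simp
  let ?l = "map (car_in_spot n \<alpha>) [Suc (b ! a)..<Suc (b ! Suc a)]"
  have "sorted_wrt (<) ?l"
    by (auto simp: sorted_wrt_iff_nth_less simp del: upt_Suc intro!: mono)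
  then have "sorted_list_of_set (set ?l) = ?l"
    by (intro sorted_list_of_set.idem_if_sorted_distinct) (auto simp: strict_sorted_iff)
  moreover have "set ?l = block a"
    by (simp only: set_map set_upt atLeastLessThanSuc_atLeastAtMost atLeastSucAtMost_greaterThanAtMost)
  ultimately show ?thesis by simp
qed

text \<open>Block sizes are differences of consecutive cuts, so the partial sums telescope to the
  cuts and \<open>psi\<close> uses the right offsets. By \<open>sorted_block\<close> ranks are
  positions in the run: rank 0 is settled by \<open>lucky_first\<close>, the others by
  \<open>displaced_later\<close>.\<close>

lemma psi_phi: "psi n (phi n \<alpha>) = \<alpha>"
proof -
  interpret P: ordered_partition n "phi n \<alpha>" by unfold_locales (rule phi_in)
  have card: "card (block a) = b ! Suc a - b ! a" if "Suc a < length b" for a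
    using card_image[OF inj_on_subset[OF car_in_spot_inj run_subset[OF that]]] by simp
  have nth: "phi n \<alpha> ! a = block a" if "Suc a < length b" for a
    using that by (simp add: phi_eq)
  have S: "P.S a = b ! a" if "a < length b" for a
    using that
  proof (induction a)
    case (Suc a)
    then show ?case using b_le[of a "Suc a"] by (simp add: P.S_Suc nth card)
  qed (simp add: b_def)
  have "psi n (phi n \<alpha>) c = \<alpha> c" if c: "c \<in> {1..n}" for c
  proof -
    from c car_in_spot_image obtain j where j: "j \<in> {1..n}" "c = car_in_spot n \<alpha> j"
      by (metis imageE)
    from ex_run[OF j(1)] obtain a where a: "Suc a < length b" "j \<in> {b ! a<..b ! Suc a}" .
    define t where "t = j - Suc (b ! a)"
    have jt: "j = b ! a + Suc t" using a by (auto simp: t_def)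
    have t: "t < card (phi n \<alpha> ! a)" using a by (auto simp: t_def nth card)
    have "sorted_list_of_set (phi n \<alpha> ! a) ! t = c"
      using a j by (subst nth[OF a(1)], subst sorted_block[OF a(1)])
        (auto simp: nth_map t_def simp del: upt_Suc)
    moreover have "a < length (phi n \<alpha>)" using a by (simp add: phi_eq)
    ultimately have "psi n (phi n \<alpha>) c = b ! a + (if t = 0 then 1 else t)"
      using P.psi_nth[OF _ t] S[of a] a by auto
    moreover have "\<alpha> c = b ! a + (if t = 0 then 1 else t)"
      using lucky_first[OF a(1)] displaced_later(1)[OF a(1), of "b ! a + t"] a j jt by auto
    ultimately show ?thesis by simp
  qed
  \<comment> \<open>Both vectors are extensional, so agreement on \<open>{1..n}\<close>
    suffices.\<close>
  with P.pref pref show ?thesis by (metis PiE_ext)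
qed

end

section \<open>The mutually inverse bijections\<close>

theorem theorem3p6:
  fixes n :: nat
  shows "psi n \<in> ordered_set_partitions n \<rightarrow> UPF n \<and>
    phi n \<in> UPF n \<rightarrow> ordered_set_partitions n \<and>
    (\<forall>Bs\<in>ordered_set_partitions n. phi n (psi n Bs) = Bs) \<and>
    (\<forall>\<alpha>\<in>UPF n. psi n (phi n \<alpha>) = \<alpha>) \<and>
    bij_betw (psi n) (ordered_set_partitions n) (UPF n) \<and>
    bij_betw (phi n) (UPF n) (ordered_set_partitions n)"
proof -
  have psi: "psi n Bs \<in> UPF n" "phi n (psi n Bs) = Bs" if "Bs \<in> ordered_set_partitions n" for Bs
  proof -
    interpret ordered_partition n Bs using that by unfold_locales
    show "psi n Bs \<in> UPF n" "phi n (psi n Bs) = Bs" by (rule UPF, rule phi_psi)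
  qed
  have phi: "phi n \<alpha> \<in> ordered_set_partitions n" "psi n (phi n \<alpha>) = \<alpha>" if "\<alpha> \<in> UPF n" for \<alpha>
    using UPF_imp_unit_parking[OF that] unit_parking.phi_in unit_parking.psi_phi by blast+
  have "bij_betw (psi n) (ordered_set_partitions n) (UPF n)"
    by (rule bij_betw_byWitness[of _ "phi n"]) (use psi phi in auto)
  moreover have "bij_betw (phi n) (UPF n) (ordered_set_partitions n)"
    by (rule bij_betw_byWitness[of _ "psi n"]) (use psi phi in auto)
  ultimately show ?thesis using psi phi by auto
qed

end
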